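(* Consider the once-punctured torus with an ideal triangulation into two triangles, with the spin structure induced from the cyclic orientation of the two triangles in the fundamental domain (clockwise on one of them, counter-clockwise on the other), and odd generators $\sigma,\theta$ attached to the two triangles. Assume that the three super lambda-lengths of the arcs of this initial triangulation all equal $1$. Then the super lambda-lengths of all arcs in the associated decorated super-Teichmüller space can be expressed using only positive coefficients; that is, putting $\varepsilon=\sigma\theta$ (so $\varepsilon^2=0$), every such super lambda-length has the form $a+b\varepsilon$ where every non-zero coefficient among $a,b$ is positive.
   Context: The decorated super-Teichmüller space associated with an oriented triangulation is a superalgebra with an even generator (super lambda-length) for each arc and an odd generator for each triangle; odd generators anticommute and square to zero. When an arc with super lambda-length $e$ in a quadrilateral with consecutive sides $a,b,c,d$ and odd generators $\theta,\sigma$ on its two triangles is flipped to an arc with super lambda-length $f$ and new odd generators $\theta',\sigma'$, the super Ptolemy relations hold: $$ef=ac+bd+\sqrt{abcd}\,\sigma\theta,\qquad \sigma'=\frac{\sigma\sqrt{bd}-\theta\sqrt{ac}}{\sqrt{ac+bd}},\qquad \theta'=\frac{\theta\sqrt{bd}+\sigma\sqrt{ac}}{\sqrt{ac+bd}},$$ where the order of the product of $\sigma$ and $\theta$ depends on the orientation of the flipped edge. A spin structure is a choice of orientations of the edges of the triangulation modulo the equivalence that reverses the orientation of all three edges of a triangle and changes the sign of its odd generator. For the once-punctured torus with the cyclically oriented spin structure of the claim, it is known (Huang–Penner–Zeitlin, Musiker) that, with $\varepsilon=\sigma\theta$, the super lambda-lengths $(x,y,z)$ of the arcs of a triangulation satisfy,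 when the initial ones are $1,1,1$, the super Markov equation $x^2+y^2+z^2+(xy+yz+xz)\varepsilon=3(1+\varepsilon)xyz$, and that flipping the arc with super lambda-length $x$ replaces $x$ by $$x'=\frac{y^2+yz\,\varepsilon+z^2}{x},$$ and similarly for $y$ and $z$, with the same $\varepsilon$, $\varepsilon^2=0$, at every flip. Hence the super lambda-lengths of arcs are the entries of all triples obtained from $(1,1,1)$ by finite sequences of these replacements, computed in the ring of elements $a+b\varepsilon$ with $\varepsilon^2=0$. *)

theory Defs
  imports Complex_Main
begin

text \<open>
  The real Grassmann algebra on two odd generators: Grass a s t u stands for
  a + s \<sigma> + t \<theta> + u \<sigma>\<theta>, where \<sigma>\<theta> = - \<theta>\<sigma> and
  \<sigma>, \<theta> square to zero.
\<close>

datatype grass = Grass (body: real) (coeff_s: real) (coeff_t: real) (coeff_st: real)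

lemma grass_eq_iff:
  "x = y \<longleftrightarrow> body x = body y \<and> coeff_s x = coeff_s y \<and> coeff_t x = coeff_t y \<and> coeff_st x = coeff_st y"
  by (cases x; cases y) auto

instantiation grass :: real_algebra_1
begin

definition "0 = Grass 0 0 0 0"
definition "1 = Grass 1 0 0 0"
definition "x + y = Grass (body x + body y) (coeff_s x + coeff_s y)
  (coeff_t x + coeff_t y) (coeff_st x + coeff_st y)"
definition "- x = Grass (- body x) (- coeff_s x) (- coeff_t x) (- coeff_st x)"
definition "x - y = Grass (body x - body y) (coeff_s x - coeff_s y)
  (coeff_t x - coeff_t y) (coeff_st x - coeff_st y)"
definition "x * y = Grass (body x * body y)
  (body x * coeff_s y + coeff_s x * body y)
  (body x * coeff_t y + coeff_t x * body y)
  (body x * coeff_st y + coeff_st x * body y + coeff_s x * coeff_t y - coeff_t x * coeff_s y)"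
definition "r *\<^sub>R x = Grass (r * body x) (r * coeff_s x) (r * coeff_t x) (r * coeff_st x)"

instance
  by standard
    (simp_all add: zero_grass_def one_grass_def plus_grass_def uminus_grass_def minus_grass_def
      times_grass_def scaleR_grass_def grass_eq_iff algebra_simps)

end

definition gen_sigma :: grass where "gen_sigma = Grass 0 1 0 0"

definition gen_theta :: grass where "gen_theta = Grass 0 0 1 0"

lemma odd_generators:
  "gen_sigma * gen_sigma = 0" "gen_theta * gen_theta = 0"
  "gen_theta * gen_sigma = - (gen_sigma * gen_theta)"
  "gen_sigma * gen_theta = Grass 0 0 0 1"
  by (simp_all add: gen_sigma_def gen_theta_def times_grass_def zero_grass_def uminus_grass_def)

lemma grass_expand:
  "x = of_real (body x) + coeff_s x *\<^sub>R gen_sigma + coeff_t x *\<^sub>R gen_theta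
       + coeff_st x *\<^sub>R (gen_sigma * gen_theta)"
  by (simp add: of_real_def gen_sigma_def gen_theta_def times_grass_def plus_grass_def
      scaleR_grass_def one_grass_def grass_eq_iff)

text \<open>
  The nilpotent part n of a + n satisfies n n = 0, so the inverse is 1/a - n/a^2 and the square
  root with positive body is sqrt a + n/(2 sqrt a).  The inverse is meaningful only for nonzero a and
  the root only for a > 0; super lambda-lengths have positive body.
\<close>

instantiation grass :: inverse
begin

definition "inverse x = Grass (1 / body x) (- coeff_s x / (body x)\<^sup>2)
  (- coeff_t x / (body x)\<^sup>2) (- coeff_st x / (body x)\<^sup>2)"
definition "x div y = x * inverse y" for x y :: grass

instance ..

end

definition gsqrt :: "grass \<Rightarrow> grass" where
  "gsqrt x = Grass (sqrt (body x)) (coeff_s x / (2 * sqrt (body x)))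
     (coeff_t x / (2 * sqrt (body x))) (coeff_st x / (2 * sqrt (body x)))"

lemma grass_inverse:
  assumes "body x \<noteq> 0"
  shows "x * inverse x = 1" and "inverse x * x = 1"
  using assms
  by (simp_all add: times_grass_def inverse_grass_def one_grass_def field_simps power2_eq_square)

lemma gsqrt_square:
  assumes "0 < body x"
  shows "gsqrt x * gsqrt x = x" and "0 < body (gsqrt x)"
  using assms by (simp_all add: gsqrt_def times_grass_def grass_eq_iff field_simps)

lemma gsqrt_unique:
  assumes "0 < body s" "s * s = x"
  shows "gsqrt x = s"
proof -
  have "sqrt (body x) = body s"
    using assms by (auto simp: times_grass_def real_sqrt_mult)
  then show ?thesis
    using assms by (auto simp: gsqrt_def times_grass_def grass_eq_iff field_simps)
qed

text \<open>
  The super Ptolemy relations for the diagonal e of a quadrilateral with consecutive sides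
  a, b, c, d.  The triangle with sides e, a, b carries \<theta> and the one with sides e, c, d carries
  \<sigma>; after the flip, the triangle with sides f, d, a carries \<theta>' and the one with sides
  f, b, c carries \<sigma>'.
\<close>

definition ptolemy_lambda ::
  "grass \<Rightarrow> grass \<Rightarrow> grass \<Rightarrow> grass \<Rightarrow> grass \<Rightarrow> grass \<Rightarrow> grass \<Rightarrow> grass" where
  "ptolemy_lambda a b c d e \<sigma> \<theta> = (a * c + b * d + gsqrt (a * b * c * d) * \<sigma> * \<theta>) / e"

definition ptolemy_sigma ::
  "grass \<Rightarrow> grass \<Rightarrow> grass \<Rightarrow> grass \<Rightarrow> grass \<Rightarrow> grass \<Rightarrow> grass" where
  "ptolemy_sigma a b c d \<sigma> \<theta> =
     (\<sigma> * gsqrt (b * d) - \<theta> * gsqrt (a * c)) / gsqrt (a * c + b * d)"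

definition ptolemy_theta ::
  "grass \<Rightarrow> grass \<Rightarrow> grass \<Rightarrow> grass \<Rightarrow> grass \<Rightarrow> grass \<Rightarrow> grass" where
  "ptolemy_theta a b c d \<sigma> \<theta> =
     (\<theta> * gsqrt (b * d) + \<sigma> * gsqrt (a * c)) / gsqrt (a * c + b * d)"

text \<open>
  A decorated oriented ideal triangulation of the once-punctured torus.  There are two triangles,
  the first and the second, and each has all three arcs as its sides, in the same
  counter-clockwise order (they are exchanged by the elliptic involution).  The arcs are listed in
  this order; lam1, lam2, lam3 are their super lambda-lengths, and the orientation arr i is True iff
  the first triangle lies to the left of the i-th arc (so the second lies to its right).  Thus all
  three orientations are True iff they run counter-clockwise around the first triangle and clockwise
  around the second one.
\<close>

record torus =
  lam1 :: grass
  lam2 :: grass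
  lam3 :: grass
  arr1 :: bool
  arr2 :: bool
  arr3 :: bool
  odd1 :: grass
  odd2 :: grass

definition rotate_arcs :: "torus \<Rightarrow> torus" where
  "rotate_arcs T = \<lparr>lam1 = lam2 T, lam2 = lam3 T, lam3 = lam1 T,
     arr1 = arr2 T, arr2 = arr3 T, arr3 = arr1 T, odd1 = odd1 T, odd2 = odd2 T\<rparr>"

text \<open>
  The equivalence of orientations defining spin structures.  Every arc is a side of either
  triangle, so reversing the sides of one triangle reverses all three orientations.
\<close>

definition reverse_first :: "torus \<Rightarrow> torus" where
  "reverse_first T = T\<lparr>arr1 := \<not> arr1 T, arr2 := \<not> arr2 T, arr3 := \<not> arr3 T, odd1 := - odd1 T\<rparr>"

definition reverse_second :: "torus \<Rightarrow> torus" where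
  "reverse_second T = T\<lparr>arr1 := \<not> arr1 T, arr2 := \<not> arr2 T, arr3 := \<not> arr3 T, odd2 := - odd2 T\<rparr>"

text \<open>
  Flip of the arc listed first.  In the quadrilateral around it, a = c is the second arc and b = d
  is the third.  The triangle to the left of the flipped arc carries \<theta>, the one to its right
  carries \<sigma>.  The new arc is oriented with \<theta>' to its left and \<sigma>' to its right, and the
  flip reverses the arc b = d and no other.  The new triangle with \<theta>' takes the place (first or
  second) of the old one with \<theta>.

  The new triangles have the sides f, d, a and f, b, c in counter-clockwise order, so the second and
  the third arc change places.  The entries arr2 and arr3 move along unchanged: a and c stay on the
  triangle in the same place, whereas b and d move to the triangle in the other place, which
  compensates the reversal of their orientation.
\<close>

definition flip_first :: "torus \<Rightarrow> torus" where
  "flip_first T =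
    (let a = lam2 T; b = lam3 T;
         \<theta> = (if arr1 T then odd1 T else odd2 T);
         \<sigma> = (if arr1 T then odd2 T else odd1 T);
         \<theta>' = ptolemy_theta a b a b \<sigma> \<theta>;
         \<sigma>' = ptolemy_sigma a b a b \<sigma> \<theta>
     in \<lparr>lam1 = ptolemy_lambda a b a b (lam1 T) \<sigma> \<theta>, lam2 = b, lam3 = a,
         arr1 = arr1 T, arr2 = arr3 T, arr3 = arr2 T,
         odd1 = (if arr1 T then \<theta>' else \<sigma>'),
         odd2 = (if arr1 T then \<sigma>' else \<theta>')\<rparr>)"

inductive flip_reachable :: "torus \<Rightarrow> torus \<Rightarrow> bool" for T0 where
  start: "flip_reachable T0 T0"
| rotate: "flip_reachable T0 T \<Longrightarrow> flip_reachable T0 (rotate_arcs T)"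
| reverse1: "flip_reachable T0 T \<Longrightarrow> flip_reachable T0 (reverse_first T)"
| reverse2: "flip_reachable T0 T \<Longrightarrow> flip_reachable T0 (reverse_second T)"
| flip: "flip_reachable T0 T \<Longrightarrow> flip_reachable T0 (flip_first T)"

text \<open>
  Every arc of the once-punctured torus belongs to an ideal triangulation, and any two ideal
  triangulations are related by flips.
\<close>

definition super_lambda_lengths :: "torus \<Rightarrow> grass set" where
  "super_lambda_lengths T0 = (\<Union>T\<in>{T. flip_reachable T0 T}. {lam1 T, lam2 T, lam3 T})"

text \<open>Counter-clockwise around the first triangle, clockwise around the second one.\<close>

definition cyclic_spin :: "torus \<Rightarrow> bool" where
  "cyclic_spin T \<longleftrightarrow> arr1 T \<and> arr2 T \<and> arr3 T"

end

theory Submission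
  imports Defs
begin

text \<open>
  The quotient in the Ptolemy relation hides the positivity, because dividing by a + b \<epsilon>
  introduces the sign - b.  The super Markov equation removes the quotient.  For fixed y and z it is
  quadratic in x, and the Ptolemy relation gives the product of the two roots, so the flipped
  length x' is also determined by their sum (Vieta jumping):
  x' = 3 (1 + \<epsilon>) y z - x - (y + z) \<epsilon>.

  In this form positivity follows from growth.  Starting at (1, 1, 1), consider only
  flips that keep an arc of maximal length.  Then both the body and the
  \<epsilon>-coefficient of the new length are at least those of the longest arc so far: the term
  3 y z dominates everything that is subtracted.  Hence all bodies stay at least 1 and all
  \<epsilon>-coefficients stay nonnegative (markov_branch_bounds).  A flip of the longest arc gives
  nothing new: Vieta jumping is an involution, so such a flip undoes the last growing step.  The
  triples produced by growing steps are therefore, up to order, closed under all flips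
  (markov_triple_flip).

  Finally, it has to be checked that \<epsilon> is the same at every flip.  For the cyclic spin
  structure the three orientations always agree, and the product of the odd
  generator on the right of the arcs with the one on their left is preserved both by flips and by
  reversals (cyclic_invariant_reachable).
\<close>

section \<open>Even elements and the Ptolemy relations\<close>

abbreviation eps :: grass where "eps \<equiv> gen_sigma * gen_theta"

definition grass_even :: "grass \<Rightarrow> bool" where
  "grass_even x \<longleftrightarrow> coeff_s x = 0 \<and> coeff_t x = 0"

definition grass_odd :: "grass \<Rightarrow> bool" where
  "grass_odd x \<longleftrightarrow> body x = 0 \<and> coeff_st x = 0"

lemmas grass_ops = zero_grass_def one_grass_def plus_grass_def uminus_grass_def minus_grass_def
  times_grass_def scaleR_grass_def gen_sigma_def gen_theta_def

text \<open>In the flips of the once-punctured torus opposite sides of the quadrilateral are the same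
  arc, so that the square root in the Ptolemy relation is the polynomial a b.\<close>

lemma ptolemy_lambda_parallelogram:
  assumes "grass_even a" "grass_even b" "0 < body a" "0 < body b"
  shows "ptolemy_lambda a b a b e \<sigma> \<theta> = (a * a + b * b + a * b * (\<sigma> * \<theta>)) / e"
proof -
  have "gsqrt (a * b * a * b) = a * b"
    by (rule gsqrt_unique)
      (use assms in \<open>simp_all add: grass_even_def grass_eq_iff times_grass_def algebra_simps\<close>)
  then show ?thesis
    by (simp add: ptolemy_lambda_def mult.assoc)
qed

text \<open>An odd element annihilates \<epsilon>, so it sees only the bodies of even factors: the new odd
  generators arise from the old ones by the real matrix with rows (B, - A) and (A, B), divided by
  sqrt (A^2 + B^2).  This is a rotation, and the product of two odd elements is a determinant.\<close>

lemma ptolemy_odd_product: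
  assumes "grass_even a" "grass_even b" "0 < body a" "0 < body b"
    and "grass_odd \<sigma>" "grass_odd \<theta>"
  shows "ptolemy_sigma a b a b \<sigma> \<theta> * ptolemy_theta a b a b \<sigma> \<theta> = \<sigma> * \<theta>" (is ?product)
    and "grass_odd (ptolemy_sigma a b a b \<sigma> \<theta>)" (is ?odd_sigma)
    and "grass_odd (ptolemy_theta a b a b \<sigma> \<theta>)" (is ?odd_theta)
proof -
  define A B r where "A = body a" and "B = body b" and "r = sqrt (A * A + B * B)"
  have "0 < A * A + B * B"
    using assms(3,4) by (simp add: A_def B_def add_pos_pos)
  then have r: "0 < r" "r * r = A * A + B * B"
    by (simp_all add: r_def)
  have aa: "gsqrt (a * a) = a" and bb: "gsqrt (b * b) = b"
    using assms by (auto intro: gsqrt_unique)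
  have sigma': "ptolemy_sigma a b a b \<sigma> \<theta> =
      Grass 0 ((coeff_s \<sigma> * B - coeff_s \<theta> * A) / r) ((coeff_t \<sigma> * B - coeff_t \<theta> * A) / r) 0"
    using assms
    by (simp add: ptolemy_sigma_def aa bb divide_grass_def inverse_grass_def gsqrt_def
        grass_ops grass_eq_iff grass_even_def grass_odd_def A_def B_def r_def)
  have theta': "ptolemy_theta a b a b \<sigma> \<theta> =
      Grass 0 ((coeff_s \<theta> * B + coeff_s \<sigma> * A) / r) ((coeff_t \<theta> * B + coeff_t \<sigma> * A) / r) 0"
    using assms
    by (simp add: ptolemy_theta_def aa bb divide_grass_def inverse_grass_def gsqrt_def
        grass_ops grass_eq_iff grass_even_def grass_odd_def A_def B_def r_def)
  show ?odd_sigma ?odd_theta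
    by (simp_all add: sigma' theta' grass_odd_def)
  let ?D = "coeff_s \<sigma> * coeff_t \<theta> - coeff_t \<sigma> * coeff_s \<theta>"
  have "(coeff_s \<sigma> * B - coeff_s \<theta> * A) / r * ((coeff_t \<theta> * B + coeff_t \<sigma> * A) / r)
      - (coeff_t \<sigma> * B - coeff_t \<theta> * A) / r * ((coeff_s \<theta> * B + coeff_s \<sigma> * A) / r)
      = (?D * (A * A + B * B)) / (r * r)"
    by (simp add: diff_divide_distrib[symmetric] algebra_simps)
  also have "\<dots> = ?D"
    using r(1) by (simp add: r(2)[symmetric])
  finally show ?product
    using assms(5,6) by (simp add: sigma' theta' times_grass_def grass_odd_def)
qed

section \<open>Vieta jumping on the super Markov equation\<close>

definition super_markov :: "grass \<Rightarrow> grass \<Rightarrow> grass \<Rightarrow> bool" where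
  "super_markov x y z \<longleftrightarrow>
     x * x + y * y + z * z + (x * y + y * z + x * z) * eps = 3 *\<^sub>R ((1 + eps) * x * y * z)"

definition vieta :: "grass \<Rightarrow> grass \<Rightarrow> grass \<Rightarrow> grass" where
  "vieta x y z = 3 *\<^sub>R ((1 + eps) * y * z) - x - (y + z) * eps"

lemma vieta_even:
  "grass_even x \<Longrightarrow> grass_even y \<Longrightarrow> grass_even z \<Longrightarrow> grass_even (vieta x y z)"
  by (simp add: vieta_def grass_even_def grass_ops)

lemma vieta_body: "body (vieta x y z) = 3 * body y * body z - body x"
  by (simp add: vieta_def grass_ops)

lemma vieta_coeff_st:
  assumes "grass_even y" "grass_even z"
  shows "coeff_st (vieta x y z) =
    3 * (body y * body z) + 3 * (body y * coeff_st z) + 3 * (coeff_st y * body z)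
      - coeff_st x - body y - body z"
  using assms by (simp add: vieta_def grass_even_def grass_ops algebra_simps)

lemma vieta_commute:
  "grass_even y \<Longrightarrow> grass_even z \<Longrightarrow> vieta x y z = vieta x z y"
  by (simp add: vieta_def grass_even_def grass_ops algebra_simps)

lemma vieta_involution: "vieta (vieta x y z) y z = x"
  by (simp add: vieta_def)

lemma super_markov_permute:
  assumes "grass_even x" "grass_even y" "grass_even z" "super_markov x y z"
  shows "super_markov y x z" and "super_markov y z x"
  using assms by (simp_all add: super_markov_def grass_even_def grass_ops algebra_simps)

lemma super_markov_vieta:
  assumes "grass_even x" "grass_even y" "grass_even z" "super_markov x y z"
  shows "super_markov (vieta x y z) y z"
proof -
  \<comment> \<open>A monic quadratic polynomial q satisfies q (s - x) = q x, where - s is its linear coefficient.\<close>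
  have "(vieta x y z * vieta x y z + y * y + z * z
        + (vieta x y z * y + y * z + vieta x y z * z) * eps)
      - 3 *\<^sub>R ((1 + eps) * vieta x y z * y * z)
    = (x * x + y * y + z * z + (x * y + y * z + x * z) * eps)
      - 3 *\<^sub>R ((1 + eps) * x * y * z)"
    using assms(1-3) by (simp add: vieta_def grass_even_def grass_ops algebra_simps)
  then show ?thesis
    using assms(4) unfolding super_markov_def by (metis right_minus_eq)
qed

text \<open>The product of the two roots is y^2 + y z \<epsilon> + z^2, and a root with nonzero body can be
  cancelled.\<close>

lemma flip_eq_vieta:
  assumes "grass_even x" "grass_even y" "grass_even z" "super_markov x y z" "body x \<noteq> 0"
  shows "(y * y + z * z + y * z * eps) / x = vieta x y z"
proof -
  have "vieta x y z * x = 3 *\<^sub>R ((1 + eps) * x * y * z) - x * x - (x * y + x * z) * eps"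
    using assms(1-3) by (simp add: vieta_def grass_even_def grass_ops algebra_simps)
  also have "\<dots> = y * y + z * z + y * z * eps"
    using assms(4)[unfolded super_markov_def, symmetric] by (simp add: algebra_simps)
  finally have "(y * y + z * z + y * z * eps) / x = vieta x y z * (x * inverse x)"
    by (simp only: divide_grass_def mult.assoc[symmetric])
  then show ?thesis
    using assms(5) by (simp add: grass_inverse)
qed

section \<open>The tree of super Markov triples\<close>

text \<open>Triples obtained by growing steps only.  The last entry is the longest one, so the rule
  jump never replaces it; the first two entries are unordered.\<close>

inductive markov_branch :: "grass \<Rightarrow> grass \<Rightarrow> grass \<Rightarrow> bool" where
  root: "markov_branch 1 1 1"
| swap: "markov_branch x y z \<Longrightarrow> markov_branch y x z"
| jump: "markov_branch x y z \<Longrightarrow> markov_branch y z (vieta x y z)"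

lemma markov_branch_even:
  "markov_branch x y z \<Longrightarrow> grass_even x \<and> grass_even y \<and> grass_even z"
proof (induction rule: markov_branch.induct)
  case root
  show ?case by (simp add: grass_even_def grass_ops)
qed (simp_all add: vieta_even)

text \<open>With all bodies at least 1 and z dominating in both components, the subtracted bodies in
  3 y z - x and 3 y z - y - z, and the subtracted coefficient of x in
  3 (y z' + y' z) - x' (primes for coefficients of \<epsilon>), are absorbed and the
  dominance passes to the new entry.\<close>

lemma markov_branch_bounds:
  assumes "markov_branch x y z"
  shows "1 \<le> body x \<and> 1 \<le> body y \<and> body x \<le> body z \<and> body y \<le> body z
    \<and> 0 \<le> coeff_st x \<and> 0 \<le> coeff_st y \<and> coeff_st x \<le> coeff_st z \<and> coeff_st y \<le> coeff_st z"
  using assms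
proof (induction rule: markov_branch.induct)
  case root
  show ?case by (simp add: grass_ops)
next
  case (swap x y z)
  then show ?case by auto
next
  case (jump x y z)
  have even: "grass_even y" "grass_even z"
    using markov_branch_even[OF jump.hyps] by auto
  have y: "1 \<le> body y" and z: "1 \<le> body z"
    using jump.IH by auto
  have "1 * body z \<le> body y * body z"
    using y z by (intro mult_right_mono) auto
  moreover have "body y * 1 \<le> body y * body z"
    using y z by (intro mult_left_mono) auto
  moreover have "1 * coeff_st z \<le> body y * coeff_st z"
    using y jump.IH by (intro mult_right_mono) auto
  moreover have "0 \<le> coeff_st y * body z"
    using z jump.IH by (intro mult_nonneg_nonneg) auto
  ultimately show ?case
    using jump.IH unfolding vieta_body vieta_coeff_st[OF even]
    by - (elim conjE, (intro conjI; linarith))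
qed

lemma markov_branch_super_markov: "markov_branch x y z \<Longrightarrow> super_markov x y z"
proof (induction rule: markov_branch.induct)
  case root
  show ?case by (simp add: super_markov_def grass_ops)
next
  case (swap x y z)
  then show ?case using super_markov_permute markov_branch_even by blast
next
  case (jump x y z)
  then show ?case
    by (meson markov_branch_even super_markov_permute(2) super_markov_vieta vieta_even)
qed

text \<open>Triples of the tree in any order: the rule swap accounts for the remaining three
  permutations.\<close>

definition markov_triple :: "grass \<Rightarrow> grass \<Rightarrow> grass \<Rightarrow> bool" where
  "markov_triple x y z \<longleftrightarrow> markov_branch x y z \<or> markov_branch y z x \<or> markov_branch z x y"

lemma markov_triple_rotate: "markov_triple x y z \<Longrightarrow> markov_triple y z x"
  by (auto simp: markov_triple_def)

lemma markov_triple_even: "markov_triple x y z \<Longrightarrow> grass_even x \<and> grass_even y \<and> grass_even z"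
  unfolding markov_triple_def using markov_branch_even by blast

lemma markov_triple_bounds:
  assumes "markov_triple x y z"
  shows "1 \<le> body x \<and> 1 \<le> body y \<and> 1 \<le> body z
    \<and> 0 \<le> coeff_st x \<and> 0 \<le> coeff_st y \<and> 0 \<le> coeff_st z"
  using assms unfolding markov_triple_def by (auto dest!: markov_branch_bounds)

lemma markov_triple_super_markov: "markov_triple x y z \<Longrightarrow> super_markov x y z"
  unfolding markov_triple_def
  using markov_branch_super_markov markov_branch_even super_markov_permute(2) by blast

text \<open>Replacing the longest entry of a triple of the tree leads to its parent.  Only the root has
  no parent, but there the longest entry is not distinguished, and replacing it is a growing
  step.\<close>

lemma markov_triple_parent: "markov_branch y z x \<Longrightarrow> markov_triple (vieta x y z) y z"
proof (induction rule: markov_branch.induct)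
  case root
  have "markov_branch 1 1 (vieta 1 1 1)"
    by (rule markov_branch.jump[OF markov_branch.root])
  then show ?case by (simp add: markov_triple_def)
next
  case (swap y z x)
  then have "vieta x z y = vieta x y z"
    using markov_branch_even vieta_commute by blast
  with swap.IH show ?case
    unfolding markov_triple_def by (metis markov_branch.swap)
next
  case (jump w y z)
  then show ?case by (simp add: vieta_involution markov_triple_def)
qed

lemma markov_triple_flip:
  assumes "markov_triple x y z"
  shows "markov_triple (vieta x y z) z y"
proof -
  have even: "grass_even y" "grass_even z"
    using markov_triple_even[OF assms] by auto
  consider "markov_branch x y z" | "markov_branch y z x" | "markov_branch z x y"
    using assms unfolding markov_triple_def by blast
  then have "markov_triple (vieta x y z) y z"
  proof cases
    case 1
    then show ?thesis
      unfolding markov_triple_def by (blast intro: markov_branch.jump)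
  next
    case 2
    then show ?thesis by (rule markov_triple_parent)
  next
    case 3
    then have "markov_branch z y (vieta x z y)"
      by (rule markov_branch.jump[OF markov_branch.swap])
    then have "markov_branch y z (vieta x y z)"
      unfolding vieta_commute[OF even] by (rule markov_branch.swap)
    then show ?thesis by (simp add: markov_triple_def)
  qed
  then show ?thesis
    unfolding markov_triple_def by (blast intro: markov_branch.swap)
qed

section \<open>Triangulations with the cyclic spin structure\<close>

text \<open>A reversal turns the counter-clockwise orientation of the first triangle into the
  clockwise one, so both have to be allowed.  The product in the invariant is that of the odd generator to the
  right of the arcs with the one to their left; a reversal exchanges the two sides and
  changes one sign, which cancels because odd elements anticommute.\<close>

definition cyclic_invariant :: "torus \<Rightarrow> bool" where
  "cyclic_invariant T \<longleftrightarrow>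
     arr2 T = arr1 T \<and> arr3 T = arr1 T
     \<and> grass_odd (odd1 T) \<and> grass_odd (odd2 T)
     \<and> (if arr1 T then odd2 T * odd1 T else odd1 T * odd2 T) = eps
     \<and> markov_triple (lam1 T) (lam2 T) (lam3 T)"

lemma grass_odd_minus: "grass_odd x \<Longrightarrow> grass_odd (- x)"
  by (simp add: grass_odd_def grass_ops)

lemma grass_odd_anticommute: "grass_odd x \<Longrightarrow> grass_odd y \<Longrightarrow> x * y = - (y * x)"
  by (simp add: grass_odd_def grass_ops)

lemma cyclic_invariant_reverse:
  assumes "cyclic_invariant T"
  shows "cyclic_invariant (reverse_first T)" and "cyclic_invariant (reverse_second T)"
proof -
  have odd: "grass_odd (odd1 T)" "grass_odd (odd2 T)"
    using assms by (simp_all add: cyclic_invariant_def)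
  have "- (odd1 T * odd2 T) = odd2 T * odd1 T" "- (odd2 T * odd1 T) = odd1 T * odd2 T"
    using grass_odd_anticommute[OF odd] by simp_all
  then show "cyclic_invariant (reverse_first T)" "cyclic_invariant (reverse_second T)"
    using assms odd
    by (cases "arr1 T"; simp add: cyclic_invariant_def reverse_first_def reverse_second_def
        grass_odd_minus)+
qed

lemma cyclic_invariant_rotate: "cyclic_invariant T \<Longrightarrow> cyclic_invariant (rotate_arcs T)"
  using markov_triple_rotate[of "lam1 T" "lam2 T" "lam3 T"]
  by (cases "arr1 T"; simp add: cyclic_invariant_def rotate_arcs_def)

lemma cyclic_invariant_flip:
  assumes "cyclic_invariant T"
  shows "cyclic_invariant (flip_first T)"
proof -
  define \<theta> \<sigma> where "\<theta> = (if arr1 T then odd1 T else odd2 T)"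
    and "\<sigma> = (if arr1 T then odd2 T else odd1 T)"
  let ?x = "lam1 T" and ?y = "lam2 T" and ?z = "lam3 T"
  have triple: "markov_triple ?x ?y ?z" and odd: "grass_odd \<sigma>" "grass_odd \<theta>"
    and prod: "\<sigma> * \<theta> = eps"
    using assms by (auto simp: cyclic_invariant_def \<theta>_def \<sigma>_def split: if_splits)
  have even: "grass_even ?x" "grass_even ?y" "grass_even ?z"
    using markov_triple_even[OF triple] by auto
  have pos: "0 < body ?x" "0 < body ?y" "0 < body ?z"
    using markov_triple_bounds[OF triple] by auto
  have "ptolemy_lambda ?y ?z ?y ?z ?x \<sigma> \<theta> = (?y * ?y + ?z * ?z + ?y * ?z * eps) / ?x"
    using ptolemy_lambda_parallelogram even pos prod by simp
  also have "\<dots> = vieta ?x ?y ?z"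
    using flip_eq_vieta even markov_triple_super_markov[OF triple] pos by simp
  finally have lam: "ptolemy_lambda ?y ?z ?y ?z ?x \<sigma> \<theta> = vieta ?x ?y ?z" .
  note odd' = ptolemy_odd_product[OF even(2,3) pos(2,3) odd]
  have "flip_first T =
      \<lparr>lam1 = vieta ?x ?y ?z, lam2 = ?z, lam3 = ?y,
       arr1 = arr1 T, arr2 = arr3 T, arr3 = arr2 T,
       odd1 = (if arr1 T then ptolemy_theta ?y ?z ?y ?z \<sigma> \<theta> else ptolemy_sigma ?y ?z ?y ?z \<sigma> \<theta>),
       odd2 = (if arr1 T then ptolemy_sigma ?y ?z ?y ?z \<sigma> \<theta> else ptolemy_theta ?y ?z ?y ?z \<sigma> \<theta>)\<rparr>"
    unfolding flip_first_def Let_def \<theta>_def[symmetric] \<sigma>_def[symmetric] lam ..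
  then show ?thesis
    using assms markov_triple_flip[OF triple] odd' prod by (simp add: cyclic_invariant_def)
qed

lemma cyclic_invariant_reachable:
  assumes "flip_reachable T0 T" and "cyclic_invariant T0"
  shows "cyclic_invariant T"
  using assms
  by (induction rule: flip_reachable.induct)
    (simp_all add: cyclic_invariant_rotate cyclic_invariant_reverse cyclic_invariant_flip)

theorem corollary3p6:
  fixes T0 :: torus and l :: grass
  assumes "cyclic_spin T0"
    and "odd1 T0 = gen_theta" and "odd2 T0 = gen_sigma"
    and "lam1 T0 = 1" and "lam2 T0 = 1" and "lam3 T0 = 1"
    and "l \<in> super_lambda_lengths T0"
  shows "\<exists>a b :: real. l = of_real a + b *\<^sub>R (gen_sigma * gen_theta)
           \<and> (a \<noteq> 0 \<longrightarrow> a > 0) \<and> (b \<noteq> 0 \<longrightarrow> b > 0)"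
proof -
  have "cyclic_invariant T0"
    using assms(1-6) markov_branch.root
    by (simp add: cyclic_invariant_def cyclic_spin_def markov_triple_def grass_odd_def
        gen_sigma_def gen_theta_def)
  moreover obtain T where "flip_reachable T0 T" and l: "l \<in> {lam1 T, lam2 T, lam3 T}"
    using assms(7) by (auto simp: super_lambda_lengths_def)
  ultimately have triple: "markov_triple (lam1 T) (lam2 T) (lam3 T)"
    using cyclic_invariant_reachable by (auto simp: cyclic_invariant_def)
  have "grass_even l" and "1 \<le> body l" and "0 \<le> coeff_st l"
    using l markov_triple_even[OF triple] markov_triple_bounds[OF triple] by auto
  moreover from \<open>grass_even l\<close> have "l = of_real (body l) + coeff_st l *\<^sub>R eps"
    using grass_expand[of l] by (simp add: grass_even_def)
  ultimately show ?thesis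
    by (intro exI[of _ "body l"] exI[of _ "coeff_st l"]) auto
qed

end
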